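(* Let $\mathcal{H}$ be a Hilbert space over $\mathbb{K}$ ($\mathbb{K}=\mathbb{R}$ or $\mathbb{C}$), let $Y$ and $Z$ be reflexive Banach spaces over $\mathbb{K}$, and let $S:\mathcal{H}\to Y$ and $T:\mathcal{H}\to Z$ be bounded linear operators with adjoints $S^\dagger:Y^*\to\mathcal{H}$ and $T^\dagger:Z^*\to\mathcal{H}$, satisfying: (Op 1) Orthogonality: $S\circ T^\dagger=0$ and $T\circ S^\dagger=0$; (Op 2) For some Hilbert space $(\widetilde{\mathcal{H}},\|\cdot\|_{\widetilde{\mathcal{H}}})$ into which $\mathcal{H}$ embeds compactly, there exists a constant $C>0$ such that, for every $h\in\mathcal{H}$, $$\|h\|_{\mathcal{H}}\le C\big(\|Sh\|_Y+\|Th\|_Z+\|h\|_{\widetilde{\mathcal{H}}}\big).$$ Assume that two sequences $\{u^\epsilon\},\{v^\epsilon\}\subset\mathcal{H}$ satisfy: (Seq 1) $u^\epsilon\rightharpoonup\bar u$ and $v^\epsilon\rightharpoonup\bar v$ weakly in $\mathcal{H}$ as $\epsilon\to0$; (Seq 2) $\{Su^\epsilon\}$ is pre-compact in $Y$, and $\{Tv^\epsilon\}$ is pre-compact in $Z$. Then $\langle u^\epsilon,v^\epsilon\rangle_{\mathcal{H}}\to\langle\bar u,\bar v\rangle_{\mathcal{H}}$ as $\epsilon\to0$.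
   Context: $\mathcal{H}$ is identified with its dual $\mathcal{H}^*$ (Riesz), so that the adjoints of $S$ and $T$ are maps $S^\dagger:Y^*\to\mathcal{H}$ and $T^\dagger:Z^*\to\mathcal{H}$ determined by $\langle h,S^\dagger a\rangle_{\mathcal H}=\langle Sh,a\rangle_Y$ and $\langle h,T^\dagger b\rangle_{\mathcal H}=\langle Th,b\rangle_Z$ for $h\in\mathcal{H}$, $a\in Y^*$, $b\in Z^*$, where $\langle\cdot,\cdot\rangle_Y$ and $\langle\cdot,\cdot\rangle_Z$ denote the duality pairings of $(Y,Y^* )$ and $(Z,Z^* )$. A pre-compact set is one with compact closure in the norm topology. In (Op 2), $\|h\|_{\widetilde{\mathcal H}}$ is the norm of the image of $h$ under the embedding. *)

theory Defs
  imports "HOL-Analysis.Analysis"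
begin

text \<open>
  The scalar field \<open>\<bbbK>\<close>. The class consists of the normed fields that embed isometrically,
  real-linearly and multiplicatively into \<^typ>\<open>complex\<close>. The image is a real subspace containing
  the reals, so up to isomorphism the only members are \<^typ>\<open>real\<close> and \<^typ>\<open>complex\<close>
  (lemma \<open>range_to_complex\<close> and the two instances below).
\<close>

class real_or_complex = real_normed_field +
  fixes to_complex :: "'a \<Rightarrow> complex"
    and kcnj :: "'a \<Rightarrow> 'a"
  assumes to_complex_add: "to_complex (x + y) = to_complex x + to_complex y"
    and to_complex_mult: "to_complex (x * y) = to_complex x * to_complex y"
    and to_complex_scaleR: "to_complex (r *\<^sub>R x) = r *\<^sub>R to_complex x"
    and norm_to_complex: "norm (to_complex x) = norm x"
    and to_complex_kcnj: "to_complex (kcnj x) = cnj (to_complex x)"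

instantiation real :: real_or_complex
begin
definition to_complex_real :: "real \<Rightarrow> complex" where "to_complex_real = complex_of_real"
definition kcnj_real :: "real \<Rightarrow> real" where "kcnj_real x = x"
instance
  by standard (simp_all add: to_complex_real_def kcnj_real_def scaleR_conv_of_real)
end

instantiation complex :: real_or_complex
begin
definition to_complex_complex :: "complex \<Rightarrow> complex" where "to_complex_complex x = x"
definition kcnj_complex :: "complex \<Rightarrow> complex" where "kcnj_complex = cnj"
instance
  by standard (simp_all add: to_complex_complex_def kcnj_complex_def)
end

lemma to_complex_one: "to_complex (1 :: 'k::real_or_complex) = 1"
proof -
  have "to_complex (1::'k) * to_complex (1::'k) = to_complex (1::'k)"
    using to_complex_mult[of "1::'k" "1::'k"] by simp
  moreover have "to_complex (1::'k) \<noteq> 0"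
    using norm_to_complex[of "1::'k"] by auto
  ultimately show ?thesis by simp
qed

lemma to_complex_of_real: "to_complex (of_real r :: 'k::real_or_complex) = of_real r"
  using to_complex_scaleR[of r "1::'k"] by (simp add: to_complex_one scaleR_conv_of_real)

lemma range_to_complex:
  "range (to_complex :: 'k::real_or_complex \<Rightarrow> complex) = \<real> \<or>
   range (to_complex :: 'k \<Rightarrow> complex) = UNIV"
proof (cases "range (to_complex :: 'k \<Rightarrow> complex) \<subseteq> \<real>")
  case True
  moreover have "complex_of_real r \<in> range (to_complex :: 'k \<Rightarrow> complex)" for r
    by (rule range_eqI) (rule to_complex_of_real[symmetric])
  then have "\<real> \<subseteq> range (to_complex :: 'k \<Rightarrow> complex)"
    by (auto elim!: Reals_cases)
  ultimately show ?thesis by blast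
next
  case False
  then obtain w :: 'k where w: "Im (to_complex w) \<noteq> 0"
    unfolding image_subset_iff complex_is_Real_iff by blast
  have "z \<in> range (to_complex :: 'k \<Rightarrow> complex)" for z
  proof -
    let ?b = "Im z / Im (to_complex w)"
    let ?x = "of_real (Re z - ?b * Re (to_complex w)) + ?b *\<^sub>R w"
    have "to_complex ?x = z"
      using w by (simp add: complex_eq_iff to_complex_add to_complex_scaleR to_complex_of_real
          del: of_real_diff of_real_mult of_real_divide)
    then show ?thesis by (rule range_eqI[OF sym])
  qed
  then show ?thesis by blast
qed

text \<open>
  A normed space over \<open>\<bbbK>\<close> is a type of class \<^class>\<open>real_normed_vector\<close> together with an explicit
  \<open>\<bbbK>\<close>-scalar multiplication compatible with the real one and with the norm; it is a Banach space
  if the type is of class \<^class>\<open>banach\<close>.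
\<close>

locale knormed_space = vector_space scale
  for scale :: "'k::real_or_complex \<Rightarrow> 'a::real_normed_vector \<Rightarrow> 'a" +
  assumes scale_of_real: "scale (of_real r) x = r *\<^sub>R x"
    and norm_scale: "norm (scale c x) = norm c * norm x"

text \<open>The inner product is linear in its first argument, as required by the identity
  \<open>\<langle>h, S\<^sup>\<dagger> a\<rangle> = \<langle>S h, a\<rangle>\<close> with \<open>a\<close> a linear functional.\<close>

locale khilbert_space = knormed_space scale
  for scale :: "'k::real_or_complex \<Rightarrow> 'h::banach \<Rightarrow> 'h" +
  fixes ip :: "'h \<Rightarrow> 'h \<Rightarrow> 'k"
  assumes ip_add_left: "ip (x + y) z = ip x z + ip y z"
    and ip_scale_left: "ip (scale c x) y = c * ip x y"
    and ip_commute: "ip y x = kcnj (ip x y)"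
    and ip_self: "ip x x = of_real ((norm x)\<^sup>2)"

lemma khilbert_space_real:
  "khilbert_space scaleR (inner :: 'h::{real_inner, banach} \<Rightarrow> 'h \<Rightarrow> real)"
proof unfold_locales
  show "inner y x = kcnj (inner x y)" for x y :: 'h
    by (simp add: kcnj_real_def inner_commute)
  show "inner x x = of_real ((norm x)\<^sup>2)" for x :: 'h
    by (simp add: power2_norm_eq_inner)
qed (simp_all add: inner_add_left scaleR_add_right scaleR_add_left)

lemma khilbert_space_complex:
  "khilbert_space ((*) :: complex \<Rightarrow> complex \<Rightarrow> complex) (\<lambda>x y. x * cnj y)"
proof unfold_locales
  show "x * cnj x = of_real ((norm x)\<^sup>2)" for x :: complex
    by (metis complex_norm_square)
qed (simp_all add: ring_distribs kcnj_complex_def scaleR_conv_of_real norm_mult)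

definition kbounded_linear ::
  "('k::real_or_complex \<Rightarrow> 'a::real_normed_vector \<Rightarrow> 'a) \<Rightarrow>
   ('k \<Rightarrow> 'b::real_normed_vector \<Rightarrow> 'b) \<Rightarrow> ('a \<Rightarrow> 'b) \<Rightarrow> bool" where
  "kbounded_linear scA scB f \<longleftrightarrow>
     Vector_Spaces.linear scA scB f \<and> (\<exists>B. \<forall>x. norm (f x) \<le> B * norm x)"

text \<open>The dual space, as a set of functions; its norm is \<^const>\<open>onorm\<close>, and the duality pairing
  of \<open>y\<close> with \<open>a\<close> is \<open>a y\<close>.\<close>

definition kdual ::
  "('k::real_or_complex \<Rightarrow> 'a::real_normed_vector \<Rightarrow> 'a) \<Rightarrow> ('a \<Rightarrow> 'k) set" where
  "kdual sc = {a. kbounded_linear sc (*) a}"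

text \<open>Surjectivity of the canonical map into the bidual. An element of the bidual is a function on
  \<^term>\<open>kdual sc\<close> (its values elsewhere are irrelevant).\<close>

definition kreflexive ::
  "('k::real_or_complex \<Rightarrow> 'a::real_normed_vector \<Rightarrow> 'a) \<Rightarrow> bool" where
  "kreflexive sc \<longleftrightarrow>
     (\<forall>F :: ('a \<Rightarrow> 'k) \<Rightarrow> 'k.
        (\<forall>a \<in> kdual sc. \<forall>b \<in> kdual sc. F (\<lambda>y. a y + b y) = F a + F b) \<longrightarrow>
        (\<forall>c. \<forall>a \<in> kdual sc. F (\<lambda>y. c * a y) = c * F a) \<longrightarrow>
        (\<exists>B. \<forall>a \<in> kdual sc. norm (F a) \<le> B * onorm a) \<longrightarrow>
        (\<exists>y. \<forall>a \<in> kdual sc. F a = a y))"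

text \<open>The adjoint of \<open>S\<close> after the Riesz identification of the Hilbert space with its dual; to be
  applied to elements of the dual of the codomain of \<open>S\<close>. By the Riesz representation theorem the
  description is then proper.\<close>

definition kadjoint :: "('h \<Rightarrow> 'h \<Rightarrow> 'k) \<Rightarrow> ('h \<Rightarrow> 'y) \<Rightarrow> ('y \<Rightarrow> 'k) \<Rightarrow> 'h" where
  "kadjoint ip S a = (THE w. \<forall>h. ip h w = a (S h))"

definition compact_embedding ::
  "('k::real_or_complex \<Rightarrow> 'a::real_normed_vector \<Rightarrow> 'a) \<Rightarrow>
   ('k \<Rightarrow> 'b::real_normed_vector \<Rightarrow> 'b) \<Rightarrow> ('a \<Rightarrow> 'b) \<Rightarrow> bool" where
  "compact_embedding scA scB \<iota> \<longleftrightarrow>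
     kbounded_linear scA scB \<iota> \<and> inj \<iota> \<and> (\<forall>B. bounded B \<longrightarrow> compact (closure (\<iota> ` B)))"

definition kweakly_tendsto ::
  "('k::real_or_complex \<Rightarrow> 'a::real_normed_vector \<Rightarrow> 'a) \<Rightarrow>
   ('i \<Rightarrow> 'a) \<Rightarrow> 'a \<Rightarrow> 'i filter \<Rightarrow> bool" where
  "kweakly_tendsto sc u l F \<longleftrightarrow> (\<forall>a \<in> kdual sc. ((\<lambda>i. a (u i)) \<longlongrightarrow> a l) F)"

end

theory Submission
  imports Defs
begin

text \<open>
  Let \<open>t\<close> be orthogonal to \<open>ker S\<close>. By \<open>S \<circ> T\<^sup>\<dagger> = 0\<close> every \<open>T\<^sup>\<dagger> b\<close> lies in \<open>ker S\<close>, so \<open>b (T t) = 0\<close> for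
  every functional \<open>b\<close>, and \<open>T t = 0\<close> by Hahn-Banach. Hence the orthogonal projection \<open>Q\<close> onto
  \<open>(ker S)\<^sup>\<bottom>\<close> and its complement \<open>P\<close> satisfy \<open>S (Q x) = S x\<close>, \<open>T (Q x) = 0\<close>, \<open>T (P x) = T x\<close>,
  \<open>S (P x) = 0\<close>. For weakly null \<open>u\<close> and \<open>v\<close>, precompactness makes \<open>S u\<close>, \<open>T v\<close> and the images of
  \<open>Q u\<close> and \<open>P v\<close> under the compact embedding converge strongly to \<open>0\<close>, so the a priori estimate
  gives \<open>Q u \<longlonglongrightarrow> 0\<close> and \<open>P v \<longlonglongrightarrow> 0\<close> in norm. The claim follows from
  \<open>\<langle>u, v\<rangle> = \<langle>Q u, v\<rangle> + \<langle>u, P v\<rangle>\<close> and the boundedness of weakly convergent sequences.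
\<close>

section \<open>The Hahn-Banach theorem\<close>

definition sublinear :: "('a::real_vector \<Rightarrow> real) \<Rightarrow> bool" where
  "sublinear p \<longleftrightarrow> (\<forall>x y. p (x + y) \<le> p x + p y) \<and> (\<forall>r\<ge>0. \<forall>x. p (r *\<^sub>R x) = r * p x)"

lemma sublinear_add: "sublinear p \<Longrightarrow> p (x + y) \<le> p x + p y"
  and sublinear_scaleR: "sublinear p \<Longrightarrow> r \<ge> 0 \<Longrightarrow> p (r *\<^sub>R x) = r * p x"
  by (auto simp: sublinear_def)

lemma sublinear_zero: "sublinear p \<Longrightarrow> p 0 = 0"
  using sublinear_scaleR[of p 0 0] by simp

lemma sublinear_minus: "sublinear p \<Longrightarrow> - p (- x) \<le> p x"
  using sublinear_add[of p x "- x"] sublinear_zero[of p] by simp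

lemma sublinear_norm: "sublinear (norm :: 'a::real_normed_vector \<Rightarrow> real)"
  by (simp add: sublinear_def norm_triangle_ineq)

text \<open>Applying \<open>scale\<close> with \<open>inverse r\<close> to
  \<open>r *\<^sub>R x\<close> yields the reverse inequality, so half of the homogeneity law
  suffices.\<close>

lemma sublinearI:
  assumes zero: "p 0 = 0"
    and add: "\<And>x y. p (x + y) \<le> p x + p y"
    and scale: "\<And>r x. r > 0 \<Longrightarrow> p (r *\<^sub>R x) \<le> r * p x"
  shows "sublinear p"
  unfolding sublinear_def
proof (intro conjI allI impI)
  fix r :: real and x
  assume "0 \<le> r"
  show "p (r *\<^sub>R x) = r * p x"
  proof (cases "r = 0")
    case False
    with \<open>0 \<le> r\<close> have "r > 0" by simp
    then have "p x \<le> inverse r * p (r *\<^sub>R x)"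
      using scale[of "inverse r" "r *\<^sub>R x"] by simp
    then have "r * p x \<le> p (r *\<^sub>R x)"
      using \<open>r > 0\<close> by (simp add: field_simps)
    with scale[OF \<open>r > 0\<close>, of x] show ?thesis by linarith
  qed (simp add: zero)
qed (rule add)

text \<open>For sublinear \<open>p\<close> this is the largest sublinear functional below
  \<open>p\<close> whose value at \<open>- z\<close> is at most \<open>- p z\<close>.\<close>

definition lower_along :: "('a::real_vector \<Rightarrow> real) \<Rightarrow> 'a \<Rightarrow> 'a \<Rightarrow> real" where
  "lower_along p z x = (INF t\<in>{0..}. p (x + t *\<^sub>R z) - t * p z)"

lemma lower_along_le:
  assumes p: "sublinear p" and t: "t \<ge> 0"
  shows "lower_along p z x \<le> p (x + t *\<^sub>R z) - t * p z"
  unfolding lower_along_def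
proof (rule cINF_lower)
  \<comment> \<open>A real infimum is informative only if bounded below. The bound comes from
    splitting \<open>s *\<^sub>R z\<close> as \<open>(x + s *\<^sub>R z) + (- x)\<close>.\<close>
  have "- p (- x) \<le> p (x + s *\<^sub>R z) - s * p z" if "s \<ge> 0" for s
    using sublinear_add[OF p, of "x + s *\<^sub>R z" "- x"] sublinear_scaleR[OF p that, of z] by simp
  then show "bdd_below ((\<lambda>t. p (x + t *\<^sub>R z) - t * p z) ` {0..})"
    by (intro bdd_belowI2[where m = "- p (- x)"]) auto
qed (use t in simp)

lemma lower_along_greatest:
  assumes "\<And>t. t \<ge> 0 \<Longrightarrow> m \<le> p (x + t *\<^sub>R z) - t * p z"
  shows "m \<le> lower_along p z x"
  unfolding lower_along_def by (rule cINF_greatest) (use assms in auto)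

lemma lower_along_le_self: "sublinear p \<Longrightarrow> lower_along p z x \<le> p x"
  using lower_along_le[of p 0 z x] by simp

text \<open>Parameters \<open>s\<close> for \<open>x\<close> and \<open>t\<close> for
  \<open>y\<close> combine to the parameter \<open>s + t\<close> for \<open>x + y\<close>, and
  \<open>t\<close> for \<open>x\<close> becomes \<open>r * t\<close> for
  \<open>r *\<^sub>R x\<close>. The two infima are taken one after the other.\<close>

lemma sublinear_lower_along:
  assumes p: "sublinear p"
  shows "sublinear (lower_along p z)"
proof (rule sublinearI)
  show "lower_along p z 0 = 0"
  proof (rule antisym)
    show "lower_along p z 0 \<le> 0"
      using lower_along_le_self[OF p, of z 0] sublinear_zero[OF p] by simp
    show "0 \<le> lower_along p z 0"
      by (rule lower_along_greatest) (simp add: sublinear_scaleR[OF p])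
  qed
next
  fix x y
  have "lower_along p z (x + y) - (p (y + t *\<^sub>R z) - t * p z) \<le> lower_along p z x" if t: "t \<ge> 0" for t
  proof (rule lower_along_greatest)
    fix s :: real assume s: "s \<ge> 0"
    have "lower_along p z (x + y) \<le> p ((x + s *\<^sub>R z) + (y + t *\<^sub>R z)) - (s + t) * p z"
      using lower_along_le[OF p, of "s + t" z "x + y"] s t by (simp add: algebra_simps)
    also have "\<dots> \<le> p (x + s *\<^sub>R z) + p (y + t *\<^sub>R z) - (s + t) * p z"
      using sublinear_add[OF p] by simp
    finally show "lower_along p z (x + y) - (p (y + t *\<^sub>R z) - t * p z) \<le> p (x + s *\<^sub>R z) - s * p z"
      by (simp add: algebra_simps)
  qed
  then have "lower_along p z (x + y) - lower_along p z x \<le> lower_along p z y"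
    by (intro lower_along_greatest) (simp add: algebra_simps)
  then show "lower_along p z (x + y) \<le> lower_along p z x + lower_along p z y" by simp
next
  fix r :: real and x assume r: "r > 0"
  have "inverse r * lower_along p z (r *\<^sub>R x) \<le> lower_along p z x"
  proof (rule lower_along_greatest)
    fix t :: real assume t: "t \<ge> 0"
    have "lower_along p z (r *\<^sub>R x) \<le> p (r *\<^sub>R x + (r * t) *\<^sub>R z) - (r * t) * p z"
      using r t by (intro lower_along_le[OF p]) simp
    also have "r *\<^sub>R x + (r * t) *\<^sub>R z = r *\<^sub>R (x + t *\<^sub>R z)"
      by (simp add: scaleR_add_right)
    also have "p \<dots> = r * p (x + t *\<^sub>R z)"
      using r by (intro sublinear_scaleR[OF p]) simp
    finally show "inverse r * lower_along p z (r *\<^sub>R x) \<le> p (x + t *\<^sub>R z) - t * p z"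
      using r by (simp add: field_simps)
  qed
  then show "lower_along p z (r *\<^sub>R x) \<le> r * lower_along p z x"
    using r by (simp add: field_simps)
qed

text \<open>This supplies the chain bounds for Zorn's lemma. Pointwise infima can destroy
  subadditivity, but along a chain the smaller of \<open>p\<close> and \<open>q\<close> serves at
  both \<open>x\<close> and \<open>y\<close>.\<close>

lemma sublinear_INF_chain:
  fixes C :: "('a::real_vector \<Rightarrow> real) set"
  assumes C: "C \<noteq> {}" "\<And>p. p \<in> C \<Longrightarrow> sublinear p"
    and chain: "\<And>p q. p \<in> C \<Longrightarrow> q \<in> C \<Longrightarrow> p \<le> q \<or> q \<le> p"
    and bdd: "\<And>x. bdd_below ((\<lambda>p. p x) ` C)"
  shows "sublinear (\<lambda>x. INF p\<in>C. p x)"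
proof -
  let ?u = "\<lambda>x. INF p\<in>C. p x"
  have lower: "?u x \<le> p x" if "p \<in> C" for p x
    by (rule cINF_lower[OF bdd that])
  have greatest: "m \<le> ?u x" if "\<And>p. p \<in> C \<Longrightarrow> m \<le> p x" for m x
    using that by (intro cINF_greatest[OF C(1)])
  show ?thesis
  proof (rule sublinearI)
    show "?u 0 = 0"
      using C by (simp add: sublinear_zero)
  next
    fix x y
    have "?u (x + y) - q y \<le> ?u x" if q: "q \<in> C" for q
    proof (rule greatest)
      fix p assume p: "p \<in> C"
      obtain m where m: "m \<in> C" "m \<le> p" "m \<le> q"
        using chain[OF p q] p q by blast
      have "?u (x + y) \<le> m (x + y)" using lower m by blast
      also have "\<dots> \<le> m x + m y" using C m sublinear_add by blast
      also have "\<dots> \<le> p x + q y" using m by (auto simp: le_fun_def intro: add_mono)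
      finally show "?u (x + y) - q y \<le> p x" by simp
    qed
    then have "?u (x + y) - ?u x \<le> ?u y"
      by (intro greatest) (simp add: algebra_simps)
    then show "?u (x + y) \<le> ?u x + ?u y" by simp
  next
    fix r :: real and x assume r: "r > 0"
    have "inverse r * ?u (r *\<^sub>R x) \<le> ?u x"
    proof (rule greatest)
      fix p assume p: "p \<in> C"
      have "?u (r *\<^sub>R x) \<le> r * p x"
        using lower[OF p, of "r *\<^sub>R x"] sublinear_scaleR[OF C(2)[OF p], of r x] r by simp
      then show "inverse r * ?u (r *\<^sub>R x) \<le> p x"
        using r by (simp add: field_simps)
    qed
    then show "?u (r *\<^sub>R x) \<le> r * ?u x"
      using r by (simp add: field_simps)
  qed
qed

text \<open>A minimal sublinear functional \<open>p\<close> coincides with \<^term>\<open>lower_along p z\<close> for all \<open>z\<close>, which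
  forces superadditivity.\<close>

lemma minimal_sublinear_imp_linear:
  assumes p: "sublinear p" and min: "\<And>q. sublinear q \<Longrightarrow> q \<le> p \<Longrightarrow> q = p"
  shows "linear p"
proof -
  have add: "p (x + z) = p x + p z" for x z
  proof (rule antisym)
    have "lower_along p z = p"
      by (intro min sublinear_lower_along p le_funI lower_along_le_self)
    then show "p x + p z \<le> p (x + z)"
      using lower_along_le[OF p, of 1 z x] by simp
  qed (rule sublinear_add[OF p])
  have minus: "p (- x) = - p x" for x
    using add[of x "- x"] sublinear_zero[OF p] by simp
  have "p (r *\<^sub>R x) = r *\<^sub>R p x" for r x
  proof (cases "r \<ge> 0")
    case False
    then have "p ((- r) *\<^sub>R x) = (- r) * p x" by (intro sublinear_scaleR p) simp
    then show ?thesis using minus[of "r *\<^sub>R x"] by simp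
  qed (simp add: sublinear_scaleR p)
  with add show ?thesis by (intro linearI)
qed

text \<open>The bound by the norm gives every sublinear functional below \<open>p\<close> the lower
  bound \<open>- norm x\<close>, so infima along chains exist. Zorn's lemma then yields a minimal
  one, which is linear.\<close>

lemma sublinear_dominates_linear:
  fixes p :: "'a::real_normed_vector \<Rightarrow> real"
  assumes p: "sublinear p" and bound: "\<And>x. p x \<le> norm x"
  obtains f where "linear f" "\<And>x. f x \<le> p x"
proof -
  define A where "A = {q. sublinear q \<and> q \<le> p}"
  have lb: "- norm x \<le> q x" if "q \<in> A" for q x
  proof -
    have "q (- x) \<le> norm x"
      using that bound[of "- x"] by (force simp: A_def le_fun_def intro: order_trans)
    with sublinear_minus[of q x] that show ?thesis by (simp add: A_def)
  qed
  have "\<exists>m\<in>A. \<forall>a\<in>A. a \<le> m \<longrightarrow> a = m"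
  \<comment> \<open>The order is reversed, so the maximal element from Zorn's lemma is minimal in
    the pointwise order.\<close>
  proof (rule predicate_Zorn)
    show "partial_order_on A (relation_of (\<lambda>a u. u \<le> a) A)"
      by (rule partial_order_on_relation_ofI) auto
  next
    fix C assume C: "C \<in> Chains (relation_of (\<lambda>a u. u \<le> a) A)"
    then have CA: "C \<subseteq> A" and chain: "\<And>q r. q \<in> C \<Longrightarrow> r \<in> C \<Longrightarrow> q \<le> r \<or> r \<le> q"
      by (auto simp: Chains_def relation_of_def)
    show "\<exists>u\<in>A. \<forall>a\<in>C. u \<le> a"
    proof (cases "C = {}")
      case True
      with p show ?thesis by (auto simp: A_def)
    next
      case False
      let ?u = "\<lambda>x. INF q\<in>C. q x"
      have bdd: "bdd_below ((\<lambda>q. q x) ` C)" for x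
        by (rule bdd_belowI2[where m = "- norm x"]) (use lb CA in blast)
      have le: "?u \<le> q" if "q \<in> C" for q
        using cINF_lower[OF bdd that] by (simp add: le_fun_def)
      have "sublinear ?u"
        using CA by (intro sublinear_INF_chain False chain bdd) (auto simp: A_def)
      moreover have "?u \<le> p"
      proof -
        obtain q where "q \<in> C" using False by blast
        then show ?thesis using le[of q] CA by (auto simp: A_def intro: order_trans)
      qed
      ultimately show ?thesis using le by (auto simp: A_def)
    qed
  qed
  then obtain m where m: "m \<in> A" "\<And>a. a \<in> A \<Longrightarrow> a \<le> m \<Longrightarrow> a = m" by blast
  have "linear m"
    using m by (intro minimal_sublinear_imp_linear) (auto simp: A_def intro: order_trans)
  moreover have "m x \<le> p x" for x
    using m(1) by (auto simp: A_def le_fun_def)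
  ultimately show thesis by (rule that)
qed

text \<open>Lowering the norm along \<open>z\<close> replaces the extension of a functional from the
  line through \<open>z\<close>: a linear \<open>f\<close> below \<open>?p\<close> has
  \<open>f (- z) \<le> - norm z\<close>, which forces equality at \<open>z\<close>.\<close>

lemma norming_functional_exists:
  fixes z :: "'a::real_normed_vector"
  obtains f :: "'a \<Rightarrow> real" where "linear f" "\<And>x. \<bar>f x\<bar> \<le> norm x" "f z = norm z"
proof -
  let ?p = "lower_along norm z"
  have p: "sublinear ?p" "\<And>x. ?p x \<le> norm x"
    by (simp_all add: sublinear_lower_along lower_along_le_self sublinear_norm)
  obtain f where f: "linear f" "\<And>x. f x \<le> ?p x"
    using sublinear_dominates_linear[OF p] by blast
  have le: "f x \<le> norm x" for x
    using f(2)[of x] p(2)[of x] by linarith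
  have minus: "f (- x) = - f x" for x
    by (rule linear_neg[OF f(1)])
  have abs: "\<bar>f x\<bar> \<le> norm x" for x
    using le[of x] le[of "- x"] minus[of x] by simp
  have "?p (- z) \<le> - norm z"
    using lower_along_le[OF sublinear_norm, of 1 z "- z"] by simp
  then have "f z = norm z"
    using f(2)[of "- z"] minus[of z] le[of z] by simp
  with f(1) abs show thesis by (rule that)
qed

section \<open>Linear functionals over the scalar field\<close>

lemma to_complex_zero [simp]: "to_complex (0 :: 'k::real_or_complex) = 0"
  using norm_to_complex[of "0 :: 'k"] by simp

lemma to_complex_minus: "to_complex (- x :: 'k::real_or_complex) = - to_complex x"
  using to_complex_add[of x "- x"] by (simp add: add_eq_0_iff)

text \<open>An additive isometry is injective. Scalar identities can therefore be verified in
  \<open>complex\<close>.\<close>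

lemma to_complex_eqD:
  assumes "to_complex (x :: 'k::real_or_complex) = to_complex y"
  shows "x = y"
proof -
  have "to_complex (x + - y) = 0"
    using assms by (simp only: to_complex_add to_complex_minus) simp
  then have "norm (x + - y) = 0" by (metis norm_to_complex norm_zero)
  then show ?thesis by simp
qed

lemma kcnj_add: "kcnj (x + y :: 'k::real_or_complex) = kcnj x + kcnj y"
  by (rule to_complex_eqD) (simp add: to_complex_kcnj to_complex_add)

lemma kcnj_mult: "kcnj (x * y :: 'k::real_or_complex) = kcnj x * kcnj y"
  by (rule to_complex_eqD) (simp add: to_complex_kcnj to_complex_mult)

lemma kcnj_kcnj: "kcnj (kcnj (x :: 'k::real_or_complex)) = x"
  by (rule to_complex_eqD) (simp add: to_complex_kcnj)

lemma kcnj_scaleR: "kcnj (r *\<^sub>R x :: 'k::real_or_complex) = r *\<^sub>R kcnj x"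
  by (rule to_complex_eqD) (simp add: to_complex_kcnj to_complex_scaleR)

lemma kcnj_zero [simp]: "kcnj (0 :: 'k::real_or_complex) = 0"
  by (rule to_complex_eqD) (simp add: to_complex_kcnj)

lemma norm_kcnj: "norm (kcnj (x :: 'k::real_or_complex)) = norm x"
  by (metis norm_to_complex to_complex_kcnj complex_mod_cnj)

section \<open>The dual space and separation of points\<close>

lemma vector_space_mult: "vector_space ((*) :: 'k::field \<Rightarrow> 'k \<Rightarrow> 'k)"
  by unfold_locales (simp_all add: algebra_simps)

lemma (in knormed_space) mem_kdual_iff:
  "a \<in> kdual scale \<longleftrightarrow> (\<forall>x y. a (x + y) = a x + a y) \<and> (\<forall>c x. a (scale c x) = c * a x) \<and>
     (\<exists>B. \<forall>x. norm (a x) \<le> B * norm x)"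
  by (simp add: kdual_def kbounded_linear_def Vector_Spaces.linear_iff vector_space_axioms
      vector_space_mult)

lemma (in knormed_space) scale_of_real_mult: "scale (of_real r * c) x = r *\<^sub>R scale c x"
  by (metis scale_of_real scale_scale)

text \<open>Over the complex numbers the functional is recovered from its real part \<open>f\<close> as
  \<open>f x - \<i> f (\<i> x)\<close>.\<close>

lemma (in knormed_space) kdual_separates_points:
  assumes "z \<noteq> 0"
  obtains b where "b \<in> kdual scale" "b z \<noteq> 0"
proof -
  obtain f where f: "linear f" "\<And>x. \<bar>f x\<bar> \<le> norm x" and fz: "f z = norm z"
    using norming_functional_exists[of z] by blast
  note f_add = linear_add[OF f(1)] and f_scaleR = linear_scale[OF f(1)]
  show thesis
  proof (cases "range (to_complex :: 'k \<Rightarrow> complex) = \<real>")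
    case True
    have c: "\<exists>r. c = of_real r" for c :: 'k
    proof -
      have "to_complex c \<in> \<real>" using rangeI[of to_complex c] unfolding True .
      then obtain r where "to_complex c = complex_of_real r" unfolding Reals_def by (rule rangeE)
      then have "to_complex c = to_complex (of_real r :: 'k)" by (simp add: to_complex_of_real)
      then have "c = of_real r" by (rule to_complex_eqD)
      then show ?thesis ..
    qed
    have "(\<lambda>x. of_real (f x) :: 'k) \<in> kdual scale"
      unfolding mem_kdual_iff
    proof (intro conjI allI exI)
      fix k :: 'k and x
      obtain r where "k = of_real r" using c by blast
      then show "of_real (f (scale k x)) = k * of_real (f x)"
        by (simp add: scale_of_real f_scaleR)
      show "norm (of_real (f x) :: 'k) \<le> 1 * norm x"
        using f(2) by simp
    qed (simp add: f_add)
    moreover have "(of_real (f z) :: 'k) \<noteq> 0" using assms fz by simp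
    ultimately show thesis by (rule that)
  next
    case False
    then have "range (to_complex :: 'k \<Rightarrow> complex) = UNIV"
      using range_to_complex by blast
    then obtain i :: 'k where i: "to_complex i = \<i>"
      by (metis UNIV_I image_iff)
    have ii: "i * i = - 1"
      by (rule to_complex_eqD, simp add: to_complex_mult to_complex_minus to_complex_one i)
    let ?b = "\<lambda>x. of_real (f x) - i * of_real (f (scale i x))"
    have "?b \<in> kdual scale"
      unfolding mem_kdual_iff
    proof (intro conjI allI exI)
      fix k :: 'k and x
      \<comment> \<open>Splitting \<open>k\<close> into real and imaginary parts writes
        \<open>scale k x\<close> and \<open>scale i (scale k x)\<close> as real combinations of
        \<open>x\<close> and \<open>scale i x\<close>, to which the real linearity of
        \<open>f\<close> applies.\<close>
      define r s where "r = Re (to_complex k)" and "s = Im (to_complex k)"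
      have k: "k = of_real r + of_real s * i"
        by (rule to_complex_eqD, simp add: to_complex_mult to_complex_add
            to_complex_of_real i r_def s_def complex_eq_iff)
      have kx: "scale k x = r *\<^sub>R x + s *\<^sub>R scale i x"
        by (simp add: k scale_left_distrib scale_of_real scale_of_real_mult)
      have "i * k = of_real r * i + of_real s * (i * i)"
        by (simp add: k algebra_simps)
      then have ik: "i * k = of_real r * i + of_real (- s) * 1"
        by (simp add: ii)
      have ikx: "scale i (scale k x) = r *\<^sub>R scale i x + (- s) *\<^sub>R x"
        unfolding scale_scale ik scale_left_distrib scale_of_real_mult by simp
      have "?b (scale k x) = of_real r * of_real (f x) + of_real s * of_real (f (scale i x))
          - i * (of_real r * of_real (f (scale i x)) - of_real s * of_real (f x))"
        unfolding kx ikx[unfolded kx] by (simp add: f_add f_scaleR linear_diff[OF f(1)])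
      also have "\<dots> = k * ?b x"
        using ii unfolding k by algebra
      finally show "?b (scale k x) = k * ?b x" .
    next
      fix x
      have "norm i = 1" by (metis i norm_to_complex norm_ii)
      then have "norm (scale i x) = norm x" by (simp add: norm_scale)
      have "norm (?b x) \<le> norm (of_real (f x) :: 'k) + norm (i * of_real (f (scale i x)))"
        by (rule norm_triangle_ineq4)
      also have "\<dots> = \<bar>f x\<bar> + \<bar>f (scale i x)\<bar>"
        using \<open>norm i = 1\<close> by (simp add: norm_mult)
      also have "\<dots> \<le> 2 * norm x"
        using f(2)[of x] f(2)[of "scale i x"] \<open>norm (scale i x) = norm x\<close> by simp
      finally show "norm (?b x) \<le> 2 * norm x" .
    qed (simp add: f_add scale_right_distrib algebra_simps)
    \<comment> \<open>The second term of \<open>?b z\<close> is purely imaginary because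
      \<open>f\<close> is real-valued, so the real part is \<open>f z\<close>.\<close>
    moreover have "Re (to_complex (?b z)) = norm z"
      unfolding diff_conv_add_uminus to_complex_add to_complex_minus to_complex_mult
      by (simp add: i to_complex_of_real fz)
    then have "?b z \<noteq> 0" using assms by auto
    ultimately show thesis by (rule that)
  qed
qed

section \<open>Bounded linear maps over the scalar field\<close>

lemma kbounded_linearD:
  assumes "kbounded_linear scA scB f"
  shows kbounded_linear_add: "f (x + y) = f x + f y"
    and kbounded_linear_scale: "f (scA c x) = scB c (f x)"
    and kbounded_linear_bound: "\<exists>B. \<forall>x. norm (f x) \<le> B * norm x"
  using assms by (auto simp: kbounded_linear_def Vector_Spaces.linear_iff)

lemma kbounded_linear_imp_bounded_linear:
  assumes "knormed_space scA" "knormed_space scB" "kbounded_linear scA scB f"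
  shows "bounded_linear f"
proof -
  obtain B where "\<And>x. norm (f x) \<le> B * norm x"
    using kbounded_linear_bound[OF assms(3)] by blast
  moreover have "f (r *\<^sub>R x) = r *\<^sub>R f x" for r x
    using kbounded_linear_scale[OF assms(3), of "of_real r" x]
    by (simp add: knormed_space.scale_of_real[OF assms(1)] knormed_space.scale_of_real[OF assms(2)])
  ultimately show ?thesis
    by (intro bounded_linear_intro[where K = B])
      (simp_all add: kbounded_linear_add[OF assms(3)] mult.commute)
qed

lemma kdual_compose:
  assumes "knormed_space scA" "knormed_space scB" "kbounded_linear scA scB f" "b \<in> kdual scB"
  shows "(\<lambda>x. b (f x)) \<in> kdual scA"
proof -
  have bl: "bounded_linear f"
    using assms(1-3) by (rule kbounded_linear_imp_bounded_linear)
  obtain B where B: "\<And>x. norm (b x) \<le> B * norm x"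
    using assms(4) by (auto simp: knormed_space.mem_kdual_iff[OF assms(2)])
  obtain K where K: "\<And>x. norm (f x) \<le> norm x * K"
    using bounded_linear.bounded[OF bl] by blast
  \<comment> \<open>The sign of \<open>B\<close> is not prescribed, hence the absolute
    value.\<close>
  have "norm (b (f x)) \<le> (\<bar>B\<bar> * K) * norm x" for x
  proof -
    have "norm (b (f x)) \<le> \<bar>B\<bar> * norm (f x)"
      using B[of "f x"] by (meson abs_ge_self mult_right_mono norm_ge_zero order_trans)
    also have "\<dots> \<le> \<bar>B\<bar> * (norm x * K)" by (intro mult_left_mono K) simp
    finally show ?thesis by (simp add: mult_ac)
  qed
  then show ?thesis
    using assms(4)
    by (auto simp: knormed_space.mem_kdual_iff[OF assms(1)] knormed_space.mem_kdual_iff[OF assms(2)]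
        kbounded_linear_add[OF assms(3)] kbounded_linear_scale[OF assms(3)])
qed

section \<open>Hilbert space geometry\<close>

context khilbert_space
begin

section \<open>The inner product and its real part\<close>

lemma ip_add_right: "ip x (y + z) = ip x y + ip x z"
  by (metis ip_commute ip_add_left kcnj_add)

lemma ip_scale_right: "ip x (scale c y) = kcnj c * ip x y"
  by (metis ip_commute ip_scale_left kcnj_mult)

lemma ip_scaleR_left: "ip (r *\<^sub>R x) y = r *\<^sub>R ip x y"
  by (metis ip_scale_left scale_of_real scaleR_conv_of_real)

lemma ip_scaleR_right: "ip x (r *\<^sub>R y) = r *\<^sub>R ip x y"
  by (metis ip_commute ip_scaleR_left kcnj_scaleR)

text \<open>A real inner product with the same norm, so that order arguments such as minimization
  also work over complex scalars.\<close>

definition rip :: "'h \<Rightarrow> 'h \<Rightarrow> real" where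
  "rip x y = Re (to_complex (ip x y))"

lemma rip_self: "rip x x = (norm x)\<^sup>2"
  by (simp add: rip_def ip_self to_complex_of_real del: of_real_power)

lemma rip_commute: "rip x y = rip y x"
  unfolding rip_def by (subst ip_commute) (simp add: to_complex_kcnj)

lemma rip_add_left: "rip (x + y) z = rip x z + rip y z"
  and rip_add_right: "rip x (y + z) = rip x y + rip x z"
  and rip_scaleR_left: "rip (r *\<^sub>R x) y = r * rip x y"
  and rip_scaleR_right: "rip x (r *\<^sub>R y) = r * rip x y"
  by (simp_all add: rip_def ip_add_left ip_add_right ip_scaleR_left ip_scaleR_right
      to_complex_add to_complex_scaleR)

lemma norm_add_sq: "(norm (x + y))\<^sup>2 = (norm x)\<^sup>2 + 2 * rip x y + (norm y)\<^sup>2"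
  using rip_commute[of x y]
  by (simp add: rip_self[symmetric] rip_add_left rip_add_right)

text \<open>The norm comes with its triangle inequality, and squaring that gives the real
  Cauchy-Schwarz inequality.\<close>

lemma rip_le: "rip x y \<le> norm x * norm y"
proof -
  have "(norm (x + y))\<^sup>2 \<le> (norm x + norm y)\<^sup>2"
    by (intro power_mono norm_triangle_ineq) simp
  then show ?thesis
    unfolding norm_add_sq by (simp add: power2_sum)
qed

text \<open>Multiplying \<open>x\<close> by the conjugate of \<open>ip x y\<close> makes the product
  with \<open>y\<close> real and nonnegative. This transfers statements from \<open>rip\<close> to
  \<open>ip\<close>.\<close>

lemma rip_scale_kcnj: "rip (scale (kcnj (ip x y)) x) y = (norm (ip x y))\<^sup>2"
proof -
  have "rip (scale (kcnj (ip x y)) x) y = Re (cnj (to_complex (ip x y)) * to_complex (ip x y))"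
    by (simp add: rip_def ip_scale_left to_complex_mult to_complex_kcnj)
  also have "\<dots> = (norm (to_complex (ip x y)))\<^sup>2"
    unfolding cmod_power2 by (simp add: power2_eq_square)
  finally show ?thesis by (simp add: norm_to_complex)
qed

lemma norm_ip_le: "norm (ip x y) \<le> norm x * norm y"
proof (cases "ip x y = 0")
  case False
  have "(norm (ip x y))\<^sup>2 \<le> norm (ip x y) * (norm x * norm y)"
    using rip_le[of "scale (kcnj (ip x y)) x" y]
    by (simp add: rip_scale_kcnj norm_scale norm_kcnj)
  with False show ?thesis by (simp add: power2_eq_square)
qed simp

lemma bounded_bilinear_ip: "bounded_bilinear ip"
proof
  show "\<exists>K. \<forall>a b. norm (ip a b) \<le> norm a * norm b * K"
    using norm_ip_le by (intro exI[of _ 1]) simp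
qed (simp_all add: ip_add_left ip_add_right ip_scaleR_left ip_scaleR_right)

sublocale ip: bounded_bilinear ip
  by (rule bounded_bilinear_ip)

lemma tendsto_rip_zero:
  assumes "((\<lambda>i. ip (x i) w) \<longlongrightarrow> 0) F"
  shows "((\<lambda>i. rip (x i) w) \<longlongrightarrow> 0) F"
proof (rule Lim_null_comparison[OF _ tendsto_norm_zero[OF assms]])
  show "\<forall>\<^sub>F i in F. norm (rip (x i) w) \<le> norm (ip (x i) w)"
    by (intro always_eventually allI) (metis abs_Re_le_cmod norm_to_complex real_norm_def rip_def)
qed

lemma ip_in_kdual: "(\<lambda>x. ip x w) \<in> kdual scale"
  unfolding mem_kdual_iff
proof (intro conjI exI[of _ "norm w"])
  show "\<forall>x. norm (ip x w) \<le> norm w * norm x"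
    using norm_ip_le[of _ w] by (simp add: mult.commute)
qed (simp_all add: ip_add_left ip_scale_left)

lemma kweakly_tendsto_ip:
  assumes "kweakly_tendsto scale x l F"
  shows "((\<lambda>i. ip (x i - l) w) \<longlongrightarrow> 0) F"
proof -
  have "((\<lambda>i. ip (x i) w) \<longlongrightarrow> ip l w) F"
    using assms ip_in_kdual by (auto simp: kweakly_tendsto_def)
  then show ?thesis
    by (simp add: ip.diff_left LIM_zero_iff)
qed

section \<open>Minimal norm and orthogonal decomposition\<close>

text \<open>A minimizing sequence is Cauchy by the parallelogram law. The inequality for its limit
  \<open>p\<close> is the first-order condition along the segment from \<open>p\<close> to
  \<open>x\<close>.\<close>

lemma convex_min_norm:
  assumes C: "closed C" "convex C" "C \<noteq> {}"
  shows "\<exists>p\<in>C. \<forall>x\<in>C. (norm p)\<^sup>2 \<le> rip p x"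
proof -
  define d where "d = (INF x\<in>C. norm x)"
  have d_le: "d \<le> norm x" if "x \<in> C" for x
    unfolding d_def by (rule cINF_lower[OF _ that]) (rule bdd_belowI2[where m = 0], simp)
  have d_nonneg: "0 \<le> d"
    unfolding d_def by (rule cINF_greatest[OF C(3)]) simp
  have "\<exists>x\<in>C. norm x < d + inverse (real (Suc n))" for n
  proof -
    have "(INF x\<in>C. norm x) < d + inverse (real (Suc n))" by (simp add: d_def)
    then show ?thesis using cInf_lessD[of "norm ` C"] C(3) by blast
  qed
  then obtain X where X: "\<And>n. X n \<in> C" "\<And>n. norm (X n) < d + inverse (real (Suc n))"
    by metis
  \<comment> \<open>Near-minimizers are close: their midpoint lies in \<open>C\<close>, so its norm
    is at least \<open>d\<close>, and the parallelogram law bounds the difference. Using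
    \<open>\<delta> \<le> 1\<close> makes the bound linear in \<open>\<delta>\<close>.\<close>
  have diff: "(norm (x - y))\<^sup>2 \<le> 4 * ((2 * d + 1) * \<delta>)"
    if "x \<in> C" "y \<in> C" "norm x \<le> d + \<delta>" "norm y \<le> d + \<delta>" "0 \<le> \<delta>" "\<delta> \<le> 1" for x y \<delta>
  proof -
    have "(1/2) *\<^sub>R x + (1/2) *\<^sub>R y \<in> C"
      using that C(2) by (intro convexD) auto
    then have "d \<le> norm ((1/2) *\<^sub>R (x + y))"
      using d_le by (simp add: scaleR_add_right)
    then have "2 * d \<le> norm (x + y)" by simp
    then have 1: "(2 * d)\<^sup>2 \<le> (norm (x + y))\<^sup>2"
      using d_nonneg by (intro power_mono) auto
    have 2: "(norm (x - y))\<^sup>2 = 2 * (norm x)\<^sup>2 + 2 * (norm y)\<^sup>2 - (norm (x + y))\<^sup>2"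
      using norm_add_sq[of x y] norm_add_sq[of x "- y"] rip_scaleR_right[of x "-1" y] by simp
    have 3: "(norm x)\<^sup>2 \<le> (d + \<delta>)\<^sup>2" "(norm y)\<^sup>2 \<le> (d + \<delta>)\<^sup>2"
      using that by (auto intro: power_mono)
    have 4: "\<delta>\<^sup>2 \<le> \<delta>"
      using that by (simp add: power2_eq_square mult_left_le)
    have "(norm (x - y))\<^sup>2 \<le> 4 * (d + \<delta>)\<^sup>2 - (2 * d)\<^sup>2"
      using 1 2 3 by linarith
    also have "\<dots> = 4 * (2 * d * \<delta> + \<delta>\<^sup>2)"
      by (simp add: power2_eq_square algebra_simps)
    also have "\<dots> \<le> 4 * (2 * d * \<delta> + \<delta>)" using 4 by simp
    finally show ?thesis by (simp add: algebra_simps)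
  qed
  have "Cauchy X"
  proof (rule metric_CauchyI)
    fix e :: real assume e: "e > 0"
    have "0 < e\<^sup>2 / (4 * (2 * d + 1))" using e d_nonneg by simp
    then obtain N where N: "inverse (real (Suc N)) < e\<^sup>2 / (4 * (2 * d + 1))"
      using reals_Archimedean by blast
    have "dist (X m) (X n) < e" if "m \<ge> N" "n \<ge> N" for m n
    proof -
      have le: "norm (X k) \<le> d + inverse (real (Suc N))" if "k \<ge> N" for k
      proof -
        have "inverse (real (Suc k)) \<le> inverse (real (Suc N))"
          using that by (intro le_imp_inverse_le) auto
        with X(2)[of k] show ?thesis by linarith
      qed
      have "inverse (real (Suc N)) \<le> 1" by (simp add: field_simps)
      then have "(norm (X m - X n))\<^sup>2 \<le> 4 * ((2 * d + 1) * inverse (real (Suc N)))"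
        by (intro diff X le that) auto
      also have "\<dots> < e\<^sup>2"
        using N d_nonneg by (simp add: pos_less_divide_eq algebra_simps)
      finally have "(norm (X m - X n))\<^sup>2 < e\<^sup>2" .
      then show ?thesis
        using e by (simp add: dist_norm power2_less_imp_less)
    qed
    then show "\<exists>N. \<forall>m\<ge>N. \<forall>n\<ge>N. dist (X m) (X n) < e" by blast
  qed
  then obtain p where p: "X \<longlonglongrightarrow> p" using Cauchy_convergent convergentD by blast
  have pC: "p \<in> C"
    using C(1) X(1) p closed_sequentially by blast
  have "norm p \<le> d"
  proof (rule LIMSEQ_le[OF tendsto_norm[OF p]])
    show "(\<lambda>n. d + inverse (real (Suc n))) \<longlonglongrightarrow> d"
      using tendsto_add[OF tendsto_const LIMSEQ_inverse_real_of_nat, of d] by simp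
  qed (use X(2) in \<open>auto intro: less_imp_le\<close>)
  have "(norm p)\<^sup>2 \<le> rip p x" if x: "x \<in> C" for x
  proof -
    \<comment> \<open>Expand the square of the norm at \<open>p + t *\<^sub>R (x - p)\<close> and
      divide by \<open>t\<close>; letting \<open>t\<close> tend to 0 from the right removes the
      quadratic term.\<close>
    have *: "0 \<le> 2 * rip p (x - p) + t * (norm (x - p))\<^sup>2" if t: "0 < t" "t \<le> 1" for t
    proof -
      have "(1 - t) *\<^sub>R p + t *\<^sub>R x \<in> C"
        using C(2) pC x t by (intro convexD) auto
      then have "p + t *\<^sub>R (x - p) \<in> C" by (simp add: algebra_simps)
      then have "norm p \<le> norm (p + t *\<^sub>R (x - p))"
        using d_le \<open>norm p \<le> d\<close> by (meson order_trans)
      then have "(norm p)\<^sup>2 \<le> (norm (p + t *\<^sub>R (x - p)))\<^sup>2"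
        by (intro power_mono) auto
      then have "0 \<le> 2 * rip p (t *\<^sub>R (x - p)) + (norm (t *\<^sub>R (x - p)))\<^sup>2"
        unfolding norm_add_sq by linarith
      also have "\<dots> = t * (2 * rip p (x - p) + t * (norm (x - p))\<^sup>2)"
        unfolding rip_scaleR_right norm_scaleR power_mult_distrib power2_abs
        by (simp add: power2_eq_square distrib_left)
      finally have "0 \<le> t * (2 * rip p (x - p) + t * (norm (x - p))\<^sup>2)" .
      then show ?thesis using t by (simp add: zero_le_mult_iff)
    qed
    have "((\<lambda>t. 2 * rip p (x - p) + t * (norm (x - p))\<^sup>2) \<longlongrightarrow> 2 * rip p (x - p) + 0 * (norm (x - p))\<^sup>2)
        (at_right 0)"
      by (intro tendsto_intros)
    moreover have "\<forall>\<^sub>F t in at_right 0. 0 \<le> 2 * rip p (x - p) + t * (norm (x - p))\<^sup>2"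
      unfolding eventually_at_right_field using * by (intro exI[of _ 1]) auto
    ultimately have "0 \<le> rip p (x - p)"
      using tendsto_lowerbound[of _ _ "at_right 0" 0] by fastforce
    then show ?thesis
      using rip_add_right[of p "x - p" p] by (simp add: rip_self)
  qed
  with pC show ?thesis by blast
qed

text \<open>The part \<open>t\<close> is the point of minimal norm in the coset of \<open>x\<close>
  modulo \<open>M\<close>. Varying it by \<open>m\<close> and \<open>- m\<close> gives
  \<open>rip m t = 0\<close>, and scaling \<open>m\<close> by a scalar upgrades this to
  \<open>ip\<close>.\<close>

lemma orthogonal_decomposition:
  assumes M: "closed M" "subspace M"
  obtains s t where "x = s + t" "s \<in> M" "\<And>m. m \<in> M \<Longrightarrow> ip m t = 0"
proof -
  let ?C = "{y. x - y \<in> M}"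
  have scaleR: "r *\<^sub>R m \<in> M" if "m \<in> M" for r m
    using subspace_scale[OF M(2) that, of "of_real r"] by (simp add: scale_of_real)
  have "closed ?C"
    using closed_vimage[OF M(1), of "\<lambda>y. x - y"] by (simp add: vimage_def continuous_intros)
  moreover have "convex ?C"
  proof (rule convexI)
    fix y z :: 'h and a b :: real
    assume "y \<in> ?C" "z \<in> ?C" and ab: "a + b = 1"
    then have "a *\<^sub>R (x - y) + b *\<^sub>R (x - z) \<in> M"
      using subspace_add[OF M(2)] scaleR by simp
    moreover have "a *\<^sub>R (x - y) + b *\<^sub>R (x - z) = (a + b) *\<^sub>R x - (a *\<^sub>R y + b *\<^sub>R z)"
      by (simp add: algebra_simps)
    ultimately show "a *\<^sub>R y + b *\<^sub>R z \<in> ?C" using ab by simp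
  qed
  moreover have "x \<in> ?C" using subspace_0[OF M(2)] by simp
  then have "?C \<noteq> {}" by blast
  ultimately have "\<exists>p\<in>?C. \<forall>y\<in>?C. (norm p)\<^sup>2 \<le> rip p y"
    by (rule convex_min_norm)
  then obtain p where p: "x - p \<in> M" "\<And>y. x - y \<in> M \<Longrightarrow> (norm p)\<^sup>2 \<le> rip p y"
    by blast
  have ge: "0 \<le> rip p m" if "m \<in> M" for m
  proof -
    have "x - (p + m) \<in> M"
      using subspace_diff[OF M(2) p(1) that] by (simp add: diff_diff_eq)
    then show ?thesis
      using p(2)[of "p + m"] by (simp add: rip_add_right rip_self)
  qed
  have rip0: "rip m p = 0" if "m \<in> M" for m
    using ge[OF that] ge[OF scaleR[OF that, of "-1"]] rip_scaleR_right[of p "-1" m] rip_commute[of m p]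
    by simp
  have "ip m p = 0" if "m \<in> M" for m
    using rip0[OF subspace_scale[OF M(2) that]] rip_scale_kcnj[of m p] by simp
  with p(1) show thesis by (intro that[of "x - p" p]) simp_all
qed

section \<open>Kernels, Riesz representation and adjoints\<close>

lemma closed_subspace_kernel:
  assumes "bounded_linear f" "\<And>c x. f (scale c x) = scB c (f x)" "\<And>c. scB c 0 = 0"
  shows "closed {x. f x = 0}" "subspace {x. f x = 0}"
proof -
  interpret f: bounded_linear f by fact
  show "closed {x. f x = 0}"
    by (intro closed_Collect_eq f.continuous_on continuous_on_id continuous_on_const)
  show "subspace {x. f x = 0}"
    by (rule subspaceI) (simp_all add: f.zero f.add assms)
qed

lemma ip_right_cancel:
  assumes "\<And>h. ip h w = ip h w'"
  shows "w = w'"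
proof -
  have "ip (w - w') (w - w') = 0" using assms by (simp add: ip.diff_right)
  then have "(norm (w - w'))\<^sup>2 = 0" by (metis ip_self of_real_eq_0_iff)
  then show ?thesis by simp
qed

text \<open>A nonzero functional is determined by its kernel and its value at one vector
  \<open>t\<close> orthogonal to the kernel, since \<open>h - scale (a h / a t) t\<close> always
  lies in the kernel.\<close>

lemma riesz_representation:
  assumes a: "a \<in> kdual scale"
  shows "\<exists>w. \<forall>h. ip h w = a h"
proof (cases "\<forall>h. a h = 0")
  case True
  then show ?thesis by (intro exI[of _ 0]) (simp add: ip.zero_right)
next
  case False
  then obtain h0 where h0: "a h0 \<noteq> 0" by blast
  have add: "a (x + y) = a x + a y" and sc: "a (scale c x) = c * a x" for x y c
    using a by (auto simp: mem_kdual_iff)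
  obtain B where B: "\<And>x. norm (a x) \<le> B * norm x"
    using a by (auto simp: mem_kdual_iff)
  have "bounded_linear a"
  proof (rule bounded_linear_intro[where K = B])
    show "a (r *\<^sub>R x) = r *\<^sub>R a x" for r x
      by (metis sc scale_of_real scaleR_conv_of_real)
  qed (simp_all add: add B mult.commute)
  then interpret a: bounded_linear a .
  obtain s t where st: "h0 = s + t" "s \<in> {x. a x = 0}" and orth: "\<And>m. m \<in> {x. a x = 0} \<Longrightarrow> ip m t = 0"
    using orthogonal_decomposition[OF closed_subspace_kernel[OF \<open>bounded_linear a\<close>, of "(*)"]]
    by (metis sc mult_zero_right)
  then have at: "a t \<noteq> 0" using h0 by (auto simp: add)
  then have "t \<noteq> 0" by (auto simp: a.zero)
  \<comment> \<open>The conjugate undoes the conjugate-linearity of \<open>ip\<close> in its second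
    argument.\<close>
  have "ip h (scale (kcnj (a t / of_real ((norm t)\<^sup>2))) t) = a h" for h
  proof -
    have "a (h - scale (a h / a t) t) = 0" using at by (simp add: a.diff sc)
    then have "ip (h - scale (a h / a t) t) t = 0" by (intro orth) simp
    then have "ip h t = a h / a t * of_real ((norm t)\<^sup>2)"
      by (simp add: ip.diff_left ip_scale_left ip_self)
    then show ?thesis
      using at \<open>t \<noteq> 0\<close> by (simp add: ip_scale_right kcnj_kcnj)
  qed
  then show ?thesis by blast
qed

text \<open>The description in \<open>kadjoint\<close> is proper: existence is Riesz representation
  of \<open>b\<close> composed with \<open>f\<close>, and uniqueness is nondegeneracy of
  \<open>ip\<close>.\<close>

lemma ip_kadjoint:
  assumes "knormed_space scB" "kbounded_linear scale scB f" "b \<in> kdual scB"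
  shows "ip h (kadjoint ip f b) = b (f h)"
proof -
  have "(\<lambda>x. b (f x)) \<in> kdual scale"
    using knormed_space_axioms assms by (rule kdual_compose)
  then obtain w where w: "\<forall>h. ip h w = b (f h)" using riesz_representation by blast
  have "\<forall>h. ip h (kadjoint ip f b) = b (f h)"
    unfolding kadjoint_def
  proof (rule theI[of _ w])
    show "w' = w" if "\<forall>h. ip h w' = b (f h)" for w'
      using that w by (intro ip_right_cancel) simp
  qed (rule w)
  then show ?thesis ..
qed

section \<open>Weakly null sequences\<close>

text \<open>This is the uniform boundedness principle: by Baire, some \<open>A k\<close> contains a
  ball, on which all functionals \<open>ip (x n)\<close> are bounded by \<open>k\<close>.\<close>

lemma weakly_null_bounded:
  assumes null: "\<And>w. (\<lambda>n. ip (x n) w) \<longlonglongrightarrow> 0"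
  shows "bounded (range x)"
proof -
  define A where "A k = {w. \<forall>n. norm (ip (x n) w) \<le> real k}" for k :: nat
  have "closed (A k)" for k
    unfolding A_def
    by (intro closed_Collect_all closed_Collect_le continuous_intros
        bounded_linear.continuous_on[OF ip.bounded_linear_right])
  moreover have "(\<Union>k. A k) = UNIV"
  proof -
    have "\<exists>k. w \<in> A k" for w
    proof -
      have "Bseq (\<lambda>n. ip (x n) w)"
        using null convergentI convergent_imp_Bseq by blast
      then obtain K where K: "\<And>n. norm (ip (x n) w) \<le> K" by (auto simp: Bseq_def)
      obtain k :: nat where "K \<le> real k" using real_arch_simple by blast
      with K show ?thesis by (auto simp: A_def intro: order_trans)
    qed
    then show ?thesis by blast
  qed
  ultimately have "\<exists>k. interior (A k) \<noteq> {}"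
    using Baire_category_alt[of "euclidean :: 'h topology" "range A"]
      completely_metrizable_space_euclidean[where 'a = 'h] by auto
  then obtain k w0 where "w0 \<in> interior (A k)" by blast
  then obtain r where r: "r > 0" "cball w0 r \<subseteq> A k"
    by (meson mem_interior_cball)
  have "norm (x n) \<le> 2 * real k / r" for n
  proof (cases "x n = 0")
    case False
    \<comment> \<open>Rescaling \<open>x n\<close> to length \<open>r\<close> keeps
      \<open>w0 + h\<close> in the ball and makes \<open>ip (x n) h\<close> equal to
      \<open>r * norm (x n)\<close>. Subtracting the values at \<open>w0 + h\<close> and
      \<open>w0\<close> costs the factor 2.\<close>
    define h where "h = (r / norm (x n)) *\<^sub>R x n"
    have "norm h = r" using False r by (simp add: h_def)
    then have "w0 + h \<in> A k" "w0 \<in> A k"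
      using r by (auto simp: dist_norm subset_iff)
    then have "norm (ip (x n) (w0 + h)) \<le> real k" "norm (ip (x n) w0) \<le> real k"
      by (auto simp: A_def)
    moreover have "norm (ip (x n) h) \<le> norm (ip (x n) (w0 + h)) + norm (ip (x n) w0)"
      using norm_triangle_ineq4[of "ip (x n) (w0 + h)" "ip (x n) w0"] by (simp add: ip_add_right)
    moreover have "norm (ip (x n) h) = r * norm (x n)"
      using False r by (simp add: h_def ip_scaleR_right ip_self power2_eq_square del: of_real_power of_real_mult)
    ultimately show ?thesis using r by (simp add: field_simps)
  qed (use r in simp)
  then show ?thesis by (auto simp: bounded_iff)
qed

text \<open>A strong limit \<open>y\<close> of a subsequence must vanish: the closed convex set
  \<open>{h. norm (L h - y) \<le> e / 2}\<close> eventually contains the subsequence, so its element of minimal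
  norm is \<open>0\<close> by weak convergence.\<close>

lemma weakly_null_image_tendsto_zero:
  fixes L :: "'h \<Rightarrow> 'b::real_normed_vector"
  assumes null: "\<And>w. (\<lambda>n. ip (x n) w) \<longlonglongrightarrow> 0"
    and L: "bounded_linear L" and K: "compact K" "\<And>n. L (x n) \<in> K"
  shows "(\<lambda>n. L (x n)) \<longlonglongrightarrow> 0"
proof (rule ccontr)
  interpret L: bounded_linear L by fact
  assume "\<not> (\<lambda>n. L (x n)) \<longlonglongrightarrow> 0"
  then obtain e where e: "e > 0" "\<not> (\<forall>\<^sub>F n in sequentially. norm (L (x n)) < e)"
    by (auto simp: tendsto_iff)
  then obtain r :: "nat \<Rightarrow> nat" where r: "strict_mono r" "\<And>n. norm (L (x (r n))) \<ge> e"
    using not_eventually_sequentiallyD[OF e(2)] unfolding not_less by blast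
  obtain y q where q: "strict_mono (q :: nat \<Rightarrow> nat)" "((\<lambda>n. L (x (r n))) \<circ> q) \<longlonglongrightarrow> y"
    using K(1) K(2) unfolding compact_def by (metis (no_types, lifting))
  define z where "z n = x (r (q n))" for n
  have Lz: "(\<lambda>n. L (z n)) \<longlonglongrightarrow> y"
    using q(2) by (simp add: o_def z_def)
  have ne: "e \<le> norm y"
    by (rule LIMSEQ_le_const[OF tendsto_norm[OF Lz]]) (use r(2) in \<open>auto simp: z_def\<close>)
  have nullz: "(\<lambda>n. ip (z n) w) \<longlonglongrightarrow> 0" for w
    using LIMSEQ_subseq_LIMSEQ[OF null strict_mono_o[OF r(1) q(1)], of w] by (simp add: o_def z_def)
  \<comment> \<open>Since \<open>e \<le> norm y\<close>, the radius \<open>e / 2\<close> keeps 0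
    outside \<open>C\<close>.\<close>
  define C where "C = L -` cball y (e / 2)"
  have "closed C"
    unfolding C_def by (intro closed_vimage closed_cball L.continuous_on continuous_on_id)
  have "convex C"
    unfolding C_def by (intro convex_linear_vimage L.linear_axioms convex_cball)
  have ev: "\<forall>\<^sub>F n in sequentially. z n \<in> C"
  proof -
    have "\<forall>\<^sub>F n in sequentially. dist (L (z n)) y < e / 2"
      by (rule tendstoD[OF Lz]) (use e(1) in simp)
    then show ?thesis
      by eventually_elim (simp add: C_def dist_commute)
  qed
  then have "C \<noteq> {}" by (auto dest: eventually_happens)
  then obtain p where p: "p \<in> C" "\<And>h. h \<in> C \<Longrightarrow> (norm p)\<^sup>2 \<le> rip p h"
    using convex_min_norm[OF \<open>closed C\<close> \<open>convex C\<close>] by blast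
  have "(norm p)\<^sup>2 \<le> 0"
  proof (rule tendsto_lowerbound[OF tendsto_rip_zero[OF nullz, of p]])
    show "\<forall>\<^sub>F n in sequentially. (norm p)\<^sup>2 \<le> rip (z n) p"
      using ev by eventually_elim (use p(2) in \<open>simp add: rip_commute[of _ p]\<close>)
  qed simp
  then have "p = 0" by simp
  with p(1) have "norm y \<le> e / 2" by (simp add: C_def L.zero)
  with ne e(1) show False by simp
qed

end

section \<open>Compensated compactness\<close>

lemma (in khilbert_space) kernel_decomposition:
  assumes "knormed_space scY" "knormed_space scZ"
    and S: "kbounded_linear scale scY S" and T: "kbounded_linear scale scZ T"
    and orth: "\<And>b. b \<in> kdual scZ \<Longrightarrow> S (kadjoint ip T b) = 0"
  obtains s t where "x = s + t" "S s = 0" "T t = 0" "\<And>m. S m = 0 \<Longrightarrow> ip m t = 0"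
proof -
  interpret Y: knormed_space scY by fact
  interpret Z: knormed_space scZ by fact
  have "bounded_linear S"
    using knormed_space_axioms assms(1) S by (rule kbounded_linear_imp_bounded_linear)
  note ker = closed_subspace_kernel[where scB = scY, OF this kbounded_linear_scale[OF S] Y.scale_zero_right]
  obtain s t where st: "x = s + t" "s \<in> {x. S x = 0}" "\<And>m. m \<in> {x. S x = 0} \<Longrightarrow> ip m t = 0"
    using orthogonal_decomposition[OF ker] by blast
  have "T t = 0"
  proof (rule ccontr)
    assume "T t \<noteq> 0"
    then obtain b where b: "b \<in> kdual scZ" "b (T t) \<noteq> 0"
      by (rule Z.kdual_separates_points)
    \<comment> \<open>The adjoint image lies in the kernel of \<open>S\<close>, hence is orthogonal
      to \<open>t\<close>; yet this product equals \<open>b (T t)\<close>.\<close>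
    have "ip t (kadjoint ip T b) = 0"
      using st(3)[of "kadjoint ip T b"] orth[OF b(1)] ip_commute[of t "kadjoint ip T b"] by simp
    with b(2) show False by (simp add: ip_kadjoint[OF assms(2) T b(1)])
  qed
  with st show thesis by (intro that) auto
qed

text \<open>Weakly null sequences are bounded, so the compact embedding makes
  \<open>\<iota> (x n)\<close> tend to 0 in norm. Then every term on the right of the estimate
  vanishes in the limit.\<close>

lemma (in khilbert_space) weakly_null_tendsto_zero:
  assumes null: "\<And>w. (\<lambda>n. ip (x n) w) \<longlonglongrightarrow> 0"
    and \<iota>: "bounded_linear \<iota>" "\<And>B. bounded B \<Longrightarrow> compact (closure (\<iota> ` B))"
    and est: "\<And>h. norm h \<le> C * (norm (S h) + norm (T h) + norm (\<iota> h))"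
    and "(\<lambda>n. S (x n)) \<longlonglongrightarrow> 0" "(\<lambda>n. T (x n)) \<longlonglongrightarrow> 0"
  shows "x \<longlonglongrightarrow> 0"
proof -
  have "(\<lambda>n. \<iota> (x n)) \<longlonglongrightarrow> 0"
  proof (rule weakly_null_image_tendsto_zero[OF null \<iota>(1)])
    show "compact (closure (\<iota> ` range x))"
      by (intro \<iota>(2) weakly_null_bounded null)
    show "\<iota> (x n) \<in> closure (\<iota> ` range x)" for n
      by (intro subsetD[OF closure_subset] imageI rangeI)
  qed
  then have "(\<lambda>n. C * (norm (S (x n)) + norm (T (x n)) + norm (\<iota> (x n)))) \<longlonglongrightarrow> C * (0 + 0 + 0)"
    by (intro tendsto_intros tendsto_norm_zero assms)
  then have lim: "(\<lambda>n. C * (norm (S (x n)) + norm (T (x n)) + norm (\<iota> (x n)))) \<longlonglongrightarrow> 0"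
    by simp
  show ?thesis
    by (rule Lim_null_comparison[OF always_eventually lim]) (simp add: est)
qed

lemma (in khilbert_space) ip_tendsto_zero:
  assumes Y: "knormed_space scY" and Z: "knormed_space scZ"
    and S: "kbounded_linear scale scY S" and T: "kbounded_linear scale scZ T"
    and orth: "\<And>b. b \<in> kdual scZ \<Longrightarrow> S (kadjoint ip T b) = 0"
    and \<iota>: "bounded_linear \<iota>" "\<And>B. bounded B \<Longrightarrow> compact (closure (\<iota> ` B))"
    and est: "\<And>h. norm h \<le> C * (norm (S h) + norm (T h) + norm (\<iota> h))"
    and u: "\<And>w. (\<lambda>n. ip (u n) w) \<longlonglongrightarrow> 0" and v: "\<And>w. (\<lambda>n. ip (v n) w) \<longlonglongrightarrow> 0"
    and Su: "(\<lambda>n. S (u n)) \<longlonglongrightarrow> 0" and Tv: "(\<lambda>n. T (v n)) \<longlonglongrightarrow> 0"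
  shows "(\<lambda>n. ip (u n) (v n)) \<longlonglongrightarrow> 0"
proof -
  have "\<forall>x. \<exists>s t. x = s + t \<and> S s = 0 \<and> T t = 0 \<and> (\<forall>m. S m = 0 \<longrightarrow> ip m t = 0)"
    using kernel_decomposition[OF Y Z S T orth] by metis
  then obtain P Q where PQ: "\<And>x. x = P x + Q x" "\<And>x. S (P x) = 0" "\<And>x. T (Q x) = 0"
    and Q_orth: "\<And>m x. S m = 0 \<Longrightarrow> ip m (Q x) = 0"
    by metis
  have S_Q: "S (Q x) = S x" for x
    using kbounded_linear_add[OF S, of "P x" "Q x"] PQ by simp
  have T_P: "T (P x) = T x" for x
    using kbounded_linear_add[OF T, of "P x" "Q x"] PQ by simp
  have P_Q: "ip (P x) (Q y) = 0" for x y
    by (rule Q_orth[OF PQ(2)])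
  have Q_P: "ip (Q x) (P y) = 0" for x y
    using P_Q[of y x] ip_commute[of "Q x" "P y"] by simp
  \<comment> \<open>Both sides equal \<open>ip (Q x) (Q w)\<close>. This symmetry passes weak
    nullity from \<open>u\<close> to \<open>Q u\<close>.\<close>
  have ip_Q: "ip (Q x) w = ip x (Q w)" for x w
    using ip_add_right[of "Q x" "P w" "Q w"] ip_add_left[of "P x" "Q x" "Q w"] PQ(1)[of w] PQ(1)[of x]
    by (simp add: P_Q Q_P)
  have ip_P: "ip (P x) w = ip x (P w)" for x w
    using ip_add_right[of "P x" "P w" "Q w"] ip_add_left[of "P x" "Q x" "P w"] PQ(1)[of w] PQ(1)[of x]
    by (simp add: P_Q Q_P)
  have Qu: "(\<lambda>n. Q (u n)) \<longlonglongrightarrow> 0"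
    by (rule weakly_null_tendsto_zero[OF _ \<iota> est]) (simp_all add: ip_Q u S_Q Su PQ)
  have Pv: "(\<lambda>n. P (v n)) \<longlonglongrightarrow> 0"
    by (rule weakly_null_tendsto_zero[OF _ \<iota> est]) (simp_all add: ip_P v T_P Tv PQ)
  \<comment> \<open>Each summand below pairs a norm-null sequence with a bounded one.\<close>
  have bdd: "Bseq u" "Bseq v"
    using weakly_null_bounded u v by (auto simp: Bseq_eq_bounded)
  have "ip (u n) (v n) = ip (Q (u n)) (v n) + ip (u n) (P (v n))" for n
    using PQ(1)[of "u n"] ip_add_left[of "P (u n)" "Q (u n)" "v n"] by (simp add: ip_P)
  moreover have "(\<lambda>n. ip (Q (u n)) (v n)) \<longlonglongrightarrow> 0" "(\<lambda>n. ip (u n) (P (v n))) \<longlonglongrightarrow> 0"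
    using ip.Zfun_prod_Bfun[of "\<lambda>n. Q (u n)" sequentially v]
      ip.Bfun_prod_Zfun[of u sequentially "\<lambda>n. P (v n)"] Qu Pv bdd
    by (simp_all add: tendsto_Zfun_iff)
  ultimately show ?thesis
    using tendsto_add[of "\<lambda>n. ip (Q (u n)) (v n)" 0 sequentially "\<lambda>n. ip (u n) (P (v n))" 0] by simp
qed

text \<open>Translating \<open>K\<close> by \<open>L l\<close> reduces a weak limit \<open>l\<close>
  to the weakly null case.\<close>

lemma (in khilbert_space) precompact_image_tendsto_zero:
  assumes "knormed_space scB" "kbounded_linear scale scB L"
    and null: "\<And>w. (\<lambda>n. ip (x n - l) w) \<longlonglongrightarrow> 0"
    and K: "compact K" "\<And>n. L (x n) \<in> K"
  shows "(\<lambda>n. L (x n - l)) \<longlonglongrightarrow> 0"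
proof -
  have "bounded_linear L"
    using knormed_space_axioms assms(1,2) by (rule kbounded_linear_imp_bounded_linear)
  then interpret L: bounded_linear L .
  show ?thesis
  proof (rule weakly_null_image_tendsto_zero[OF null \<open>bounded_linear L\<close>])
    show "compact ((\<lambda>k. k - L l) ` K)"
      by (rule compact_translation_subtract[OF K(1)])
    show "L (x n - l) \<in> (\<lambda>k. k - L l) ` K" for n
      using K(2) by (simp add: L.diff)
  qed
qed

theorem theorem3p1:
  fixes scH :: "'k::real_or_complex \<Rightarrow> 'h::banach \<Rightarrow> 'h"
    and ipH :: "'h \<Rightarrow> 'h \<Rightarrow> 'k"
    and scY :: "'k \<Rightarrow> 'y::banach \<Rightarrow> 'y"
    and scZ :: "'k \<Rightarrow> 'z::banach \<Rightarrow> 'z"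
    and scG :: "'k \<Rightarrow> 'g::banach \<Rightarrow> 'g"
    and ipG :: "'g \<Rightarrow> 'g \<Rightarrow> 'k"
    and S :: "'h \<Rightarrow> 'y" and T :: "'h \<Rightarrow> 'z" and \<iota> :: "'h \<Rightarrow> 'g"
    and E :: "real set" and u v :: "real \<Rightarrow> 'h" and u0 v0 :: 'h
  assumes H: "khilbert_space scH ipH"
    and Y: "knormed_space scY" "kreflexive scY"
    and Z: "knormed_space scZ" "kreflexive scZ"
    and S: "kbounded_linear scH scY S"
    and T: "kbounded_linear scH scZ T"
    and Op1: "\<forall>b \<in> kdual scZ. S (kadjoint ipH T b) = 0"
             "\<forall>a \<in> kdual scY. T (kadjoint ipH S a) = 0"
    and Op2: "khilbert_space scG ipG" "compact_embedding scH scG \<iota>"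
             "\<exists>C>0. \<forall>h. norm h \<le> C * (norm (S h) + norm (T h) + norm (\<iota> h))"
    and E: "E \<subseteq> {0<..}" "0 islimpt E"
    and Seq1: "kweakly_tendsto scH u u0 (at 0 within E)"
              "kweakly_tendsto scH v v0 (at 0 within E)"
    and Seq2: "compact (closure ((\<lambda>\<epsilon>. S (u \<epsilon>)) ` E))"
              "compact (closure ((\<lambda>\<epsilon>. T (v \<epsilon>)) ` E))"
  shows "((\<lambda>\<epsilon>. ipH (u \<epsilon>) (v \<epsilon>)) \<longlongrightarrow> ipH u0 v0) (at 0 within E)"
proof -
  interpret H: khilbert_space scH ipH by (fact H)
  interpret G: khilbert_space scG ipG by (fact Op2(1))
  obtain C where C: "\<And>h. norm h \<le> C * (norm (S h) + norm (T h) + norm (\<iota> h))"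
    using Op2(3) by blast
  have \<iota>: "bounded_linear \<iota>" "\<And>B. bounded B \<Longrightarrow> compact (closure (\<iota> ` B))"
    using Op2(2) kbounded_linear_imp_bounded_linear[OF H.knormed_space_axioms G.knormed_space_axioms]
    by (auto simp: compact_embedding_def)
  show ?thesis
    \<comment> \<open>Passing to arbitrary sequences in \<open>E - {0}\<close> tending to 0 makes
      the sequential lemmas applicable.\<close>
    unfolding tendsto_at_iff_sequentially o_def
  proof (intro allI impI)
    fix X :: "nat \<Rightarrow> real"
    assume X: "\<forall>i. X i \<in> E - {0}" "X \<longlonglongrightarrow> 0"
    have filt: "filterlim X (at 0 within E) sequentially"
      using X by (simp add: filterlim_at)
    have u: "(\<lambda>n. ipH (u (X n) - u0) w) \<longlonglongrightarrow> 0" for w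
      using filterlim_compose[OF H.kweakly_tendsto_ip[OF Seq1(1)] filt] .
    have v: "(\<lambda>n. ipH (v (X n) - v0) w) \<longlonglongrightarrow> 0" for w
      using filterlim_compose[OF H.kweakly_tendsto_ip[OF Seq1(2)] filt] .
    have mem: "f (X n) \<in> closure (f ` E)" for f :: "real \<Rightarrow> 'x::topological_space" and n
      using X(1) by (intro subsetD[OF closure_subset] imageI) simp
    have "(\<lambda>n. S (u (X n) - u0)) \<longlonglongrightarrow> 0"
      by (rule H.precompact_image_tendsto_zero[OF Y(1) S u Seq2(1) mem])
    moreover have "(\<lambda>n. T (v (X n) - v0)) \<longlonglongrightarrow> 0"
      by (rule H.precompact_image_tendsto_zero[OF Z(1) T v Seq2(2) mem])
    ultimately have diff: "(\<lambda>n. ipH (u (X n) - u0) (v (X n) - v0)) \<longlonglongrightarrow> 0"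
      using Op1(1) by (intro H.ip_tendsto_zero[OF Y(1) Z(1) S T _ \<iota> C u v]) auto
    \<comment> \<open>Weak convergence controls the first slot of \<open>ipH\<close>; swapping the
      slots conjugates the value and preserves its norm.\<close>
    have v': "(\<lambda>n. ipH u0 (v (X n) - v0)) \<longlonglongrightarrow> 0"
      by (rule tendsto_norm_zero_cancel)
        (use tendsto_norm_zero[OF v[of u0]] in
          \<open>simp add: H.ip_commute[of u0] norm_kcnj\<close>)
    \<comment> \<open>Expanding around the weak limits leaves the product of differences and two
      mixed terms, all tending to 0.\<close>
    have "ipH (u (X n)) (v (X n)) =
        ipH (u (X n) - u0) (v (X n) - v0) + ipH u0 (v (X n) - v0) + ipH (u (X n) - u0) v0
        + ipH u0 v0" for n
      by (simp add: H.ip.diff_left H.ip.diff_right)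
    then show "(\<lambda>n. ipH (u (X n)) (v (X n))) \<longlonglongrightarrow> ipH u0 v0"
      using tendsto_add[OF tendsto_add[OF tendsto_add[OF diff v'] u] tendsto_const, of v0 "ipH u0 v0"]
      by simp
  qed
qed

end
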